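(* Let $n\ge 3$, $N=\frac{n(n-1)}{2}$, $A=(a_{ij})\in\mathbb{C}^{n\times n}$, and let $A^{(k)}=(a^{(k)}_{ij})$, $k\ge 0$, denote the matrix obtained from $A^{(0)}=A$ after performing $k$ iterations of the naive Jacobi algorithm under a fixed (arbitrary) cyclic pivot strategy. Let $\mu_k=\min_{i\ne j}|a^{(k)}_{ii}-a^{(k)}_{jj}|$ and $\eta_k=\max_{i\neq j}|a^{(k)}_{ij}|$. Assume that $\mu_0>0$ and $$80(n-1)\frac{\eta_0}{\mu_0}\le 1 .$$ Then the iteration process converges quadratically, that is, with the constant $C=\frac{80(n-1)}{\mu_0}$ (depending only on $n$ and $\mu_0$), for every $k\ge 0$, $$\eta_{(k+1)N}\le C\,\eta_{kN}^2$$ and $$\mathrm{off}\left(A^{((k+1)N)}\right)\le C\sqrt{2N}\;\mathrm{off}^2\left(A^{(kN)}\right).$$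
   Context: The off-norm of $A\in\mathbb{C}^{n\times n}$ is $\mathrm{off}(A)=\big(\sum_{i\ne j}|a_{ij}|^2\big)^{1/2}$, and $\mathrm{off}^2(A)=(\mathrm{off}(A))^2$. All computations are in exact arithmetic. Naive Jacobi step. For $A\in\mathbb{C}^{n\times n}$ and a pivot pair $(p,q)$, $1\le p<q\le n$, the step replaces $A$ by $S^{-1}T^{-1}ATS$, where $T=I+x\,e_pe_q^T$, $S=I+y\,e_qe_p^T$ ($e_i$ standard basis vectors) and $x,y\in\mathbb{C}$ are chosen as follows. (1) If $a_{pq}=a_{qp}=0$, or if $a_{pq}a_{qp}=0$ and $a_{pp}=a_{qq}$, the pair is skipped: $x=y=0$. (2) If $a_{pq}\ne0$ and $a_{qp}\neq 0$: let $d=a_{qq}-a_{pp}$ and $s=\sqrt{d^2+4a_{qp}a_{pq}}$ (a fixed choice of complex square root, e.g. principal). If $s=0$ the pair is skipped ($x=y=0$). Otherwise let $\sigma=1$ if $|d+s|>|d-s|$ and $\sigma=-1$ otherwise, and put $x=\frac{2a_{pq}}{d+\sigma s}$, $y=-\sigma\frac{a_{qp}}{s}$. (Thus $x$ is a root of smaller modulus of $a_{qp}x^2+(a_{qq}-a_{pp})x-a_{pq}=0$.) (3) If $a_{pq}\neq0$, $a_{qp}=0$, $a_{pp}\ne a_{qq}$: $x=\frac{a_{pq}}{a_{qq}-a_{pp}}$, $y=0$. (4) If $a_{pq}=0$, $a_{qp}\ne0$, $a_{pp}\neq a_{qq}$: $x=0$, $y=\frac{a_{qp}}{a_{pp}-a_{qq}}$.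 When the pair is not skipped, the step makes the entries at $(p,q)$ and $(q,p)$ zero. Naive Jacobi algorithm. Given pivot pairs $(p_k,q_k)$, $k\ge0$, set $A^{(0)}=A$ and let $A^{(k+1)}$ be the result of the naive Jacobi step applied to $A^{(k)}$ with pivot pair $(p_k,q_k)$ and parameters $x=x_k$, $y=y_k$. A cyclic pivot strategy fixes an ordering of all $N=n(n-1)/2$ pairs $(p,q)$, $1\le p<q\le n$, and repeats this ordering periodically; $N$ consecutive steps $kN,\dots,(k+1)N-1$ form one cycle. *)

theory Defs
  imports "HOL-Analysis.Analysis"
begin

text \<open>The index set \<open>{1, \<dots>, n}\<close> is an arbitrary finite linearly ordered type \<open>'n\<close>
  with \<open>n = CARD('n)\<close>; the order is only needed to speak of pivot pairs \<open>p < q\<close>.\<close>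

definition off :: "complex^'n^'n \<Rightarrow> real" where
  "off A = sqrt (\<Sum>(i, j) \<in> {(i, j). i \<noteq> j}. (cmod (A $ i $ j))\<^sup>2)"

definition diag_gap :: "complex^'n^'n \<Rightarrow> real" where
  "diag_gap A = Min {cmod (A $ i $ i - A $ j $ j) | i j. i \<noteq> j}"

definition max_off :: "complex^'n^'n \<Rightarrow> real" where
  "max_off A = Max {cmod (A $ i $ j) | i j. i \<noteq> j}"

text \<open>The matrix \<open>I + c e\<^sub>p e\<^sub>q\<^sup>T\<close>.\<close>

definition elem_mat :: "'n \<Rightarrow> 'n \<Rightarrow> complex \<Rightarrow> complex^'n^'n" where
  "elem_mat p q c = mat 1 + (\<chi> i j. if i = p \<and> j = q then c else 0)"

text \<open>The parameters \<open>(x, y)\<close> of the naive Jacobi step. The argument \<open>rt\<close> is the chosen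
  complex square root function (for instance \<^const>\<open>csqrt\<close>).\<close>

definition jacobi_params ::
    "(complex \<Rightarrow> complex) \<Rightarrow> complex^'n^'n \<Rightarrow> 'n \<Rightarrow> 'n \<Rightarrow> complex \<times> complex" where
  "jacobi_params rt A p q =
    (let app = A $ p $ p; apq = A $ p $ q; aqp = A $ q $ p; aqq = A $ q $ q in
     if (apq = 0 \<and> aqp = 0) \<or> (apq * aqp = 0 \<and> app = aqq) then (0, 0)
     else if apq \<noteq> 0 \<and> aqp \<noteq> 0 then
       (let d = aqq - app; s = rt (d\<^sup>2 + 4 * aqp * apq) in
        if s = 0 then (0, 0)
        else
          (let \<sigma> = (if cmod (d + s) > cmod (d - s) then 1 else - 1)
           in (2 * apq / (d + \<sigma> * s), - \<sigma> * (aqp / s))))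
     else if apq \<noteq> 0 then (apq / (aqq - app), 0)
     else (0, aqp / (app - aqq)))"

definition jacobi_step ::
    "(complex \<Rightarrow> complex) \<Rightarrow> 'n \<times> 'n \<Rightarrow> complex^'n^'n \<Rightarrow> complex^'n^'n" where
  "jacobi_step rt pq A =
    (let (p, q) = pq; (x, y) = jacobi_params rt A p q;
         T = elem_mat p q x; S = elem_mat q p y
     in matrix_inv S ** matrix_inv T ** A ** T ** S)"

primrec jacobi_iter ::
    "(complex \<Rightarrow> complex) \<Rightarrow> (nat \<Rightarrow> 'n \<times> 'n) \<Rightarrow> complex^'n^'n \<Rightarrow> nat \<Rightarrow> complex^'n^'n" where
  "jacobi_iter rt piv A 0 = A"
| "jacobi_iter rt piv A (Suc k) = jacobi_step rt (piv k) (jacobi_iter rt piv A k)"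

text \<open>The first \<open>n(n-1)/2\<close> pivots enumerate all pairs \<open>p < q\<close> exactly once, and this
  ordering is repeated periodically.\<close>

definition cyclic_pivot_strategy :: "(nat \<Rightarrow> 'n::{finite,linorder} \<times> 'n) \<Rightarrow> bool" where
  "cyclic_pivot_strategy piv \<longleftrightarrow>
    (let N = CARD('n) * (CARD('n) - 1) div 2 in
     bij_betw piv {..<N} {(p, q). p < q} \<and> (\<forall>k. piv (k + N) = piv k))"

end

(* When all off-diagonal entries are at most M and the diagonal gaps at least \<gamma> >> M, the
   parameters of a step are O(M/\<gamma>), so a step changes every non-pivot entry by O(M^2/\<gamma>) and
   annihilates the pivot entries. In one cycle every off-diagonal entry is annihilated once and
   changed by at most 2(n-1) steps, so it ends up of size O(n M^2/\<gamma>). The diagonal entries move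
   by O(n M^2/\<gamma>) too, and since M at least halves in every cycle, the gaps
   never drop below 9/10 of their initial value. *)
theory Submission
  imports Defs
begin

section \<open>Elementary matrices and their inverses\<close>

lemma elem_mat_mult_left:
  "(elem_mat p q c ** A) $ i $ j = A $ i $ j + (if i = p then c * A $ q $ j else 0)"
proof -
  have "(elem_mat p q c ** A) $ i $ j
      = (\<Sum>k\<in>UNIV. (if i = k then A $ k $ j else 0) + (if k = q then (if i = p then c * A $ k $ j else 0) else 0))"
    unfolding matrix_matrix_mult_def elem_mat_def mat_def
    by (simp add: algebra_simps) (rule sum.cong, auto)
  also have "\<dots> = A $ i $ j + (if i = p then c * A $ q $ j else 0)"
    by (simp add: sum.distrib)
  finally show ?thesis .
qed

lemma elem_mat_mult_right:
  "(A ** elem_mat p q c) $ i $ j = A $ i $ j + (if j = q then c * A $ i $ p else 0)"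
proof -
  have "(A ** elem_mat p q c) $ i $ j
      = (\<Sum>k\<in>UNIV. (if k = j then A $ i $ k else 0) + (if k = p then (if j = q then c * A $ i $ k else 0) else 0))"
    unfolding matrix_matrix_mult_def elem_mat_def mat_def
    by (simp add: algebra_simps) (rule sum.cong, auto)
  also have "\<dots> = A $ i $ j + (if j = q then c * A $ i $ p else 0)"
    by (simp add: sum.distrib)
  finally show ?thesis .
qed

text \<open>For distinct indices the parameters add under multiplication, so
  \<open>elem_mat p q (- c)\<close> is a two-sided inverse. As \<open>matrix_inv\<close> is a
  Hilbert choice, uniqueness of inverses is still needed to identify the chosen matrix with
  it.\<close>

lemma matrix_inv_elem_mat:
  assumes "p \<noteq> q"
  shows "matrix_inv (elem_mat p q c) = elem_mat p q (- c)"
proof -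
  have *: "elem_mat p q a ** elem_mat p q b = mat 1" if "a + b = 0" for a b
    using assms that
    by (simp add: vec_eq_iff elem_mat_mult_left) (auto simp: elem_mat_def mat_def add_eq_0_iff)
  have "elem_mat p q c ** matrix_inv (elem_mat p q c) = mat 1
      \<and> matrix_inv (elem_mat p q c) ** elem_mat p q c = mat 1"
    unfolding matrix_inv_def by (rule someI[of _ "elem_mat p q (- c)"]) (simp add: *)
  note inv = conjunct1[OF this]
  have "matrix_inv (elem_mat p q c) = elem_mat p q (- c) ** (elem_mat p q c ** matrix_inv (elem_mat p q c))"
    by (simp add: matrix_mul_assoc *)
  also have "\<dots> = elem_mat p q (- c)"
    by (simp add: inv)
  finally show ?thesis .
qed

section \<open>Parameters and effect of a single step\<close>

text \<open>The two equations are what annihilates the pivot entries: the quadratic one clears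
  position (p,q) under T, the linear one then clears (q,p) under S. A gap of at least 4M makes d and
  s nonzero, so a pair is skipped only if both its entries already vanish. It also keeps the
  denominators of x/2 and y at least \<gamma>/2.\<close>

lemma jacobi_params_props:
  assumes rt: "\<And>z. (rt z)\<^sup>2 = z"
    and gap: "\<gamma> \<le> cmod (A $ q $ q - A $ p $ p)"
    and pq: "cmod (A $ p $ q) \<le> M" and qp: "cmod (A $ q $ p) \<le> M"
    and "0 < \<gamma>" and "4 * M \<le> \<gamma>"
    and xy: "jacobi_params rt A p q = (x, y)"
  shows "cmod x \<le> 2 * M / \<gamma>" and "cmod y \<le> 2 * M / \<gamma>"
    and "A $ q $ p * x\<^sup>2 + (A $ q $ q - A $ p $ p) * x - A $ p $ q = 0"
    and "A $ q $ p + y * (A $ q $ q - A $ p $ p + 2 * x * A $ q $ p) = 0"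
proof -
  define d b c where "d = A $ q $ q - A $ p $ p" and "b = A $ p $ q" and "c = A $ q $ p"
  have d: "\<gamma> \<le> cmod d" "d \<noteq> 0" and b: "cmod b \<le> M" and c: "cmod c \<le> M" and "0 \<le> M"
    using gap pq qp \<open>0 < \<gamma>\<close> order_trans[OF norm_ge_zero pq] by (auto simp: d_def b_def c_def)
  have small: "cmod (u / w) \<le> 2 * M / \<gamma>" if "cmod u \<le> M" "\<gamma> / 2 \<le> cmod w" for u w
  proof -
    have "cmod (u / w) \<le> M / (\<gamma> / 2)"
      unfolding norm_divide using that \<open>0 < \<gamma>\<close> \<open>0 \<le> M\<close> by (intro frac_le) auto
    then show ?thesis by (simp add: field_simps)
  qed
  consider (zero) "b = 0" "c = 0" | (full) "b \<noteq> 0" "c \<noteq> 0" | (upper) "b \<noteq> 0" "c = 0" | (lower) "b = 0" "c \<noteq> 0"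
    by blast
  then have "cmod x \<le> 2 * M / \<gamma> \<and> cmod y \<le> 2 * M / \<gamma>
      \<and> c * x\<^sup>2 + d * x - b = 0 \<and> c + y * (d + 2 * x * c) = 0"
  proof cases
    case zero
    then have "x = 0" "y = 0"
      using xy by (auto simp: jacobi_params_def Let_def b_def c_def)
    then show ?thesis using zero \<open>0 \<le> M\<close> \<open>0 < \<gamma>\<close> by simp
  next
    case full
    define s where "s = rt (d\<^sup>2 + 4 * c * b)"
    define \<sigma> :: complex where "\<sigma> = (if cmod (d + s) > cmod (d - s) then 1 else - 1)"
    define w where "w = d + \<sigma> * s"
    have s2: "s\<^sup>2 = d\<^sup>2 + 4 * c * b" by (simp add: s_def rt)
    have \<sigma>2: "\<sigma>\<^sup>2 = 1" and \<sigma>n: "cmod \<sigma> = 1" by (auto simp: \<sigma>_def)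
    have "cmod c * cmod b \<le> M * M"
      using b c by (intro mult_mono) (auto simp: \<open>0 \<le> M\<close>)
    then have cb: "cmod (4 * c * b) \<le> 4 * M\<^sup>2"
      by (simp add: norm_mult power2_eq_square)
    \<comment> \<open>As 16 M^2 is at most \<gamma>^2, the term 4cb has modulus at most
      \<gamma>^2/4. This leaves 3/4 of \<gamma>^2 for the square of |s|, more than the required
      quarter.\<close>
    have "(4 * M)\<^sup>2 \<le> \<gamma>\<^sup>2" and "\<gamma>\<^sup>2 \<le> (cmod d)\<^sup>2"
      using \<open>0 \<le> M\<close> \<open>4 * M \<le> \<gamma>\<close> \<open>0 < \<gamma>\<close> d by (intro power_mono; simp)+
    moreover have "cmod (d\<^sup>2) - cmod (4 * c * b) \<le> cmod (s\<^sup>2)"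
      unfolding s2 by (rule norm_diff_ineq)
    ultimately have "(\<gamma> / 2)\<^sup>2 \<le> (cmod s)\<^sup>2"
      using cb by (simp add: norm_power power_divide power_mult_distrib)
        (use zero_le_power2[of \<gamma>] in linarith)
    then have s: "\<gamma> / 2 \<le> cmod s" by (rule power2_le_imp_le) simp
    \<comment> \<open>The sign \<sigma> selects the larger of |d+s| and |d-s|, whose mean is at
      least |d|.\<close>
    have "2 * cmod d \<le> cmod (d + s) + cmod (d - s)"
      using norm_triangle_ineq[of "d + s" "d - s"] by (simp add: norm_mult flip: mult_2)
    then have w: "cmod d \<le> cmod w"
      by (auto simp: w_def \<sigma>_def)
    have nz: "s \<noteq> 0" "w \<noteq> 0" using s w d \<open>0 < \<gamma>\<close> by auto
    have "(x, y) = (2 * b / w, - \<sigma> * (c / s))"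
      using full nz xy[unfolded jacobi_params_def Let_def, folded b_def c_def d_def, folded s_def,
          folded \<sigma>_def, folded w_def]
      by simp
    then have x: "x = 2 * b / w" and y: "y = - \<sigma> * (c / s)" by auto
    \<comment> \<open>This is the quadratic equation for x after substituting x = 2b/w and clearing
      denominators.\<close>
    have w2: "w\<^sup>2 = 2 * d * w + 4 * b * c"
      by (simp add: w_def power2_sum power_mult_distrib \<sigma>2 s2) (simp add: algebra_simps power2_eq_square)
    \<comment> \<open>Divided by w, this identifies the derivative d + 2xc of the quadratic at its
      root x with \<sigma>s; since \<sigma>^2 = 1, y equals -c divided by that derivative.\<close>
    have "d * w + 2 * (2 * b) * c = w * (\<sigma> * s)"
    proof -
      have "w * (\<sigma> * s) = w\<^sup>2 - d * w" by (simp add: w_def power2_eq_square algebra_simps)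
      then show ?thesis using w2 by (simp add: algebra_simps)
    qed
    then have ds: "d + 2 * x * c = \<sigma> * s"
      using nz by (simp add: x field_simps)
    have "cmod x = cmod (b / (w / 2))" by (simp add: x mult.commute)
    also have "\<dots> \<le> 2 * M / \<gamma>" using b w d by (intro small) (auto simp: norm_divide)
    finally have 1: "cmod x \<le> 2 * M / \<gamma>" .
    have 2: "cmod y \<le> 2 * M / \<gamma>"
      using small[OF c s] by (simp only: y norm_mult norm_minus_cancel \<sigma>n mult_1_left)
    have "(c * x\<^sup>2 + d * x - b) * w\<^sup>2 = b * (4 * b * c + 2 * d * w - w\<^sup>2)"
      using nz by (simp add: x field_simps power2_eq_square)
    also have "\<dots> = 0" by (simp add: w2)
    finally have 3: "c * x\<^sup>2 + d * x - b = 0" using nz by simp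
    have "y * (\<sigma> * s) = - (\<sigma>\<^sup>2 * c)" using nz by (simp add: y power2_eq_square)
    then have 4: "c + y * (d + 2 * x * c) = 0" by (simp add: ds \<sigma>2)
    show ?thesis using 1 2 3 4 by blast
  next
    case upper
    then have "x = b / d" "y = 0"
      using xy d(2) by (auto simp: jacobi_params_def Let_def b_def c_def d_def)
    then show ?thesis using upper small[OF b, of d] d \<open>0 \<le> M\<close> \<open>0 < \<gamma>\<close> by simp
  next
    case lower
    then have "x = 0" "y = c / (- d)"
      using xy d(2) by (auto simp: jacobi_params_def Let_def b_def c_def d_def)
    then show ?thesis using lower small[OF c, of "- d"] d \<open>0 \<le> M\<close> \<open>0 < \<gamma>\<close> by simp
  qed
  then show "cmod x \<le> 2 * M / \<gamma>" "cmod y \<le> 2 * M / \<gamma>"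
    "A $ q $ p * x\<^sup>2 + (A $ q $ q - A $ p $ p) * x - A $ p $ q = 0"
    "A $ q $ p + y * (A $ q $ q - A $ p $ p + 2 * x * A $ q $ p) = 0"
    by (auto simp: b_def c_def d_def)
qed

text \<open>Outside the pivot positions a change is a parameter of size r = 2M/\<gamma> times
  off-diagonal data of size M. The worst case is r M (1 + r), and r at most 1/20 yields the constant
  2 * 21/20 = 21/10. The condition on {i, j} admits diagonal entries, so these too move only by a
  quadratically small amount.\<close>

lemma jacobi_step_change:
  assumes rt: "\<And>z. (rt z)\<^sup>2 = z" and "p \<noteq> q"
    and gap: "\<And>i j. i \<noteq> j \<Longrightarrow> \<gamma> \<le> cmod (A $ i $ i - A $ j $ j)"
    and bound: "\<And>i j. i \<noteq> j \<Longrightarrow> cmod (A $ i $ j) \<le> M"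
    and "0 < \<gamma>" and "40 * M \<le> \<gamma>"
  defines "A' \<equiv> jacobi_step rt (p, q) A"
    and "\<delta> \<equiv> 21 / 10 * M\<^sup>2 / \<gamma>"
  shows "A' $ p $ q = 0" and "A' $ q $ p = 0"
    and "{i, j} \<noteq> {p, q} \<Longrightarrow> cmod (A' $ i $ j - A $ i $ j) \<le> \<delta>"
    and "i \<notin> {p, q} \<Longrightarrow> j \<notin> {p, q} \<Longrightarrow> A' $ i $ j = A $ i $ j"
proof -
  obtain x y where xy: "jacobi_params rt A p q = (x, y)" by fastforce
  have "0 \<le> M" using norm_ge_zero bound[OF \<open>p \<noteq> q\<close>] by (rule order_trans)
  have "4 * M \<le> \<gamma>" using \<open>0 \<le> M\<close> \<open>40 * M \<le> \<gamma>\<close> by linarith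
  note * = jacobi_params_props[OF rt gap bound bound \<open>0 < \<gamma>\<close> this xy]
  define r where "r = 2 * M / \<gamma>"
  have x: "cmod x \<le> r" and y: "cmod y \<le> r"
    and rx: "A $ q $ p * x\<^sup>2 + (A $ q $ q - A $ p $ p) * x - A $ p $ q = 0"
    and ry: "A $ q $ p + y * (A $ q $ q - A $ p $ p + 2 * x * A $ q $ p) = 0"
    using * \<open>p \<noteq> q\<close> by (auto simp: r_def)
  have r: "0 \<le> r" "r \<le> 1 / 20"
    using \<open>0 \<le> M\<close> \<open>40 * M \<le> \<gamma>\<close> \<open>0 < \<gamma>\<close> by (auto simp: r_def field_simps)
  define B where "B = elem_mat p q (- x) ** A ** elem_mat p q x"
  have A': "A' = elem_mat q p (- y) ** B ** elem_mat q p y"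
    using \<open>p \<noteq> q\<close> by (simp add: A'_def jacobi_step_def xy matrix_inv_elem_mat B_def matrix_mul_assoc)
  have Bij: "B $ i $ j = A $ i $ j - (if i = p then x * A $ q $ j else 0)
      + (if j = q then x * (A $ i $ p - (if i = p then x * A $ q $ p else 0)) else 0)" for i j
    by (simp add: B_def elem_mat_mult_left elem_mat_mult_right)
  have A'ij: "A' $ i $ j = B $ i $ j - (if i = q then y * B $ p $ j else 0)
      + (if j = p then y * (B $ i $ q - (if i = q then y * B $ p $ q else 0)) else 0)" for i j
    by (simp add: A' elem_mat_mult_left elem_mat_mult_right)
  \<comment> \<open>This zero removes every contribution of y to the diagonal and to (p,q), as well
    as the y^2 term at (q,p). Hence the equation for y is linear.\<close>
  have Bpq: "B $ p $ q = 0"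
    using rx \<open>p \<noteq> q\<close> by (simp add: Bij power2_eq_square algebra_simps)
  show "A' $ p $ q = 0" using \<open>p \<noteq> q\<close> by (simp add: A'ij Bpq)
  show "A' $ q $ p = 0" using \<open>p \<noteq> q\<close> ry by (simp add: A'ij Bpq) (simp add: Bij algebra_simps)
  show "A' $ i $ j = A $ i $ j" if "i \<notin> {p, q}" "j \<notin> {p, q}"
    using that by (simp add: A'ij Bij)
  have "r * M * (1 + r) \<le> r * M * (21 / 20)"
    using r \<open>0 \<le> M\<close> by (intro mult_left_mono) auto
  also have "\<dots> = \<delta>" by (simp add: \<delta>_def r_def power2_eq_square)
  finally have \<delta>: "r * M * (1 + r) \<le> \<delta>" .
  have one: "cmod (z * u) \<le> r * M" if "cmod z \<le> r" "cmod u \<le> M" for z u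
    unfolding norm_mult using that r by (intro mult_mono) auto
  have single: "cmod (z * u) \<le> \<delta>" if "cmod z \<le> r" "cmod u \<le> M" for z u
  proof -
    have "r * M * 1 \<le> r * M * (1 + r)" using r \<open>0 \<le> M\<close> by (intro mult_left_mono) auto
    then show ?thesis using one[OF that] \<delta> by linarith
  qed
  \<comment> \<open>This covers column p and row q, where S multiplies by y an entry that T has
    already modified; z is x or -x.\<close>
  have double: "cmod (y * (u + z * v)) \<le> \<delta>" if "cmod z \<le> r" "cmod u \<le> M" "cmod v \<le> M" for z u v
  proof -
    have "cmod (u + z * v) \<le> M + r * M" using one[OF that(1,3)] that(2) norm_triangle_le by (meson add_mono)
    then have "cmod (y * (u + z * v)) \<le> r * (M + r * M)"
      unfolding norm_mult using y r by (intro mult_mono) auto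
    then show ?thesis using \<delta> by (simp add: algebra_simps)
  qed
  show "cmod (A' $ i $ j - A $ i $ j) \<le> \<delta>" if ne: "{i, j} \<noteq> {p, q}"
  proof -
    have 0: "cmod (0 :: complex) \<le> \<delta>" using \<open>0 < \<gamma>\<close> by (simp add: \<delta>_def)
    have nz: "cmod (- x) \<le> r" using x by simp
    consider (pp) "i = p" "j = p" | (qq) "i = q" "j = q"
      | (rp) "i \<notin> {p, q}" "j = p" | (rq) "i \<notin> {p, q}" "j = q"
      | (pr) "i = p" "j \<notin> {p, q}" | (qr) "i = q" "j \<notin> {p, q}"
      | (rr) "i \<notin> {p, q}" "j \<notin> {p, q}"
      using ne by auto
    then show ?thesis
    proof cases
      case pp
      have "A' $ i $ j - A $ i $ j = - x * A $ q $ p"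
        using pp \<open>p \<noteq> q\<close> by (simp add: A'ij Bpq) (simp add: Bij)
      then show ?thesis using single[OF nz bound] \<open>p \<noteq> q\<close> by metis
    next
      case qq
      have "A' $ i $ j - A $ i $ j = x * A $ q $ p"
        using qq \<open>p \<noteq> q\<close> by (simp add: A'ij Bpq) (simp add: Bij)
      then show ?thesis using single[OF x bound] \<open>p \<noteq> q\<close> by metis
    next
      case rp
      have "A' $ i $ j - A $ i $ j = y * (A $ i $ q + x * A $ i $ p)"
        using rp \<open>p \<noteq> q\<close> by (auto simp: A'ij Bij)
      then show ?thesis using double[OF x bound bound] rp by auto
    next
      case rq
      have "A' $ i $ j - A $ i $ j = x * A $ i $ p"
        using rq \<open>p \<noteq> q\<close> by (auto simp: A'ij Bij)
      then show ?thesis using single[OF x bound] rq by auto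
    next
      case pr
      have "A' $ i $ j - A $ i $ j = - x * A $ q $ j"
        using pr \<open>p \<noteq> q\<close> by (auto simp: A'ij Bij)
      then show ?thesis using single[OF nz bound] pr by auto
    next
      case qr
      have "A' $ i $ j - A $ i $ j = - (y * (A $ p $ j + (- x) * A $ q $ j))"
        using qr \<open>p \<noteq> q\<close> by (auto simp: A'ij Bij)
      then show ?thesis using double[OF nz bound bound] qr by (auto simp del: mult_minus_left)
    next
      case rr
      then show ?thesis using 0 by (simp add: A'ij Bij)
    qed
  qed
qed

lemma exists_distinct:
  assumes "CARD('n::finite) \<ge> 2"
  shows "\<exists>i j :: 'n. i \<noteq> j"
  using assms card_le_Suc0_iff_eq[of "UNIV :: 'n set"] by fastforce

section \<open>Accumulated changes during one cycle\<close>

text \<open>A ledger for errors: a change of entry (i,j) is charged to whichever of its two indices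
  occurs in the pivot. This keeps the bound per entry linear in n.\<close>

definition touches :: "(nat \<Rightarrow> 'n \<times> 'n) \<Rightarrow> 'n \<Rightarrow> nat \<Rightarrow> nat" where
  "touches piv i t = card {s. s < t \<and> (i = fst (piv s) \<or> i = snd (piv s))}"

lemma touches_0 [simp]: "touches piv i 0 = 0"
  by (simp add: touches_def)

lemma touches_Suc:
  "touches piv i (Suc t) = touches piv i t + (if i = fst (piv t) \<or> i = snd (piv t) then 1 else 0)"
proof -
  have "{s. s < Suc t \<and> (i = fst (piv s) \<or> i = snd (piv s))}
      = {s. s < t \<and> (i = fst (piv s) \<or> i = snd (piv s))}
        \<union> (if i = fst (piv t) \<or> i = snd (piv t) then {t} else {})"
    by (auto simp: less_Suc_eq)
  then show ?thesis by (simp add: touches_def)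
qed

text \<open>The steps touching i inject into the other n - 1 indices by way of the second member of
  the pivot: together with i it determines the pair, since pivots are ordered, and the pair
  determines the step.\<close>

lemma touches_le:
  fixes piv :: "nat \<Rightarrow> 'n::{finite,linorder} \<times> 'n"
  assumes inj: "inj_on piv {..<N}" and less: "\<And>s. s < N \<Longrightarrow> fst (piv s) < snd (piv s)"
    and "t \<le> N"
  shows "touches piv i t \<le> CARD('n) - 1"
proof -
  let ?S = "{s. s < t \<and> (i = fst (piv s) \<or> i = snd (piv s))}"
  let ?partner = "\<lambda>s. if i = fst (piv s) then snd (piv s) else fst (piv s)"
  have "s = s'" if "s \<in> ?S" "s' \<in> ?S" "?partner s = ?partner s'" for s s'
  proof (rule inj_onD[OF inj])
    have "fst (piv s) < snd (piv s)" "fst (piv s') < snd (piv s')"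
      using that \<open>t \<le> N\<close> by (auto intro: less)
    with that show "piv s = piv s'" by (auto simp: prod_eq_iff split: if_splits)
  qed (use that \<open>t \<le> N\<close> in auto)
  then have "inj_on ?partner ?S" by (rule inj_onI)
  moreover have "?partner ` ?S \<subseteq> UNIV - {i}"
  proof
    fix k assume "k \<in> ?partner ` ?S"
    then obtain s where s: "s < t" "k = ?partner s" "i = fst (piv s) \<or> i = snd (piv s)" by blast
    with \<open>t \<le> N\<close> have "fst (piv s) < snd (piv s)" by (intro less) simp
    then have "k \<noteq> i" using s(2,3) by (metis less_irrefl)
    then show "k \<in> UNIV - {i}" by simp
  qed
  ultimately have "card ?S \<le> card (UNIV - {i})"
    by (intro card_inj_on_le finite)
  then show ?thesis by (simp add: touches_def)
qed

text \<open>A step changes an entry only if it touches its row or column index, hence an entry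
  is changed at most \<open>2 (n - 1)\<close> times per cycle; counting all \<open>n (n - 1) / 2\<close> steps instead
  would not give a bound compatible with the smallness hypothesis.\<close>

lemma jacobi_cycle:
  fixes A :: "complex^('n::{finite,linorder})^('n::{finite,linorder})"
  assumes rt: "\<And>z. (rt z)\<^sup>2 = z"
    and inj: "inj_on piv {..<N}" and less: "\<And>s. s < N \<Longrightarrow> fst (piv s) < snd (piv s)"
    and gap: "\<And>i j. i \<noteq> j \<Longrightarrow> 9 / 10 * g \<le> cmod (A $ i $ i - A $ j $ j)"
    and bound: "\<And>i j. i \<noteq> j \<Longrightarrow> cmod (A $ i $ j) \<le> h"
    and "0 < g" and small: "80 * (real CARD('n) - 1) * h \<le> g" and n: "CARD('n) \<ge> 3"
    and "t \<le> N"
  defines "\<delta> \<equiv> 84 / 5 * h\<^sup>2 / g" and "B \<equiv> jacobi_iter rt piv A"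
  shows "i \<noteq> j \<Longrightarrow> cmod (B t $ i $ j) \<le> h + \<delta> * (touches piv i t + touches piv j t)"
    and "\<exists>s<t. piv s = (i, j) \<or> piv s = (j, i)
      \<Longrightarrow> cmod (B t $ i $ j) \<le> \<delta> * (touches piv i t + touches piv j t)"
    and "cmod (B t $ i $ i - A $ i $ i) \<le> \<delta> * touches piv i t"
proof -
  obtain u v :: 'n where "u \<noteq> v"
    using n exists_distinct[where 'n = 'n] by fastforce
  then have "0 \<le> h" using norm_ge_zero bound order_trans by blast
  have \<delta>0: "0 \<le> \<delta>" using \<open>0 < g\<close> by (simp add: \<delta>_def)
  \<comment> \<open>Here n - 1 is at least 2. The resulting bound is exactly the condition 40 M
    \<le> \<gamma> of a single step with M = 2h and \<gamma> = g/2.\<close>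
  have "160 * h \<le> 80 * (real CARD('n) - 1) * h"
    using n \<open>0 \<le> h\<close> by (intro mult_right_mono) auto
  then have hg: "160 * h \<le> g" using small by linarith
  have "\<delta> * (real CARD('n) - 1) = 84 / 5 / 80 * (h * (80 * (real CARD('n) - 1) * h) / g)"
    using \<open>0 < g\<close> by (simp add: \<delta>_def power2_eq_square field_simps)
  also have "\<dots> \<le> 84 / 5 / 80 * (h * g / g)"
    using small \<open>0 \<le> h\<close> \<open>0 < g\<close> by (intro mult_left_mono divide_right_mono) auto
  also have "\<dots> \<le> h / 4" using \<open>0 \<le> h\<close> \<open>0 < g\<close> by simp
  finally have \<delta>n: "\<delta> * (real CARD('n) - 1) \<le> h / 4" .
  \<comment> \<open>Each index thus accounts for at most h/4: off-diagonal entries stay below 3h/2,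
    and a diagonal gap loses at most h/2. This is what keeps the single-step estimate applicable
    with 2h and g/2.\<close>
  have deg: "\<delta> * touches piv i t \<le> h / 4" if "t \<le> N" for i t
  proof -
    have "touches piv i t \<le> CARD('n) - 1" by (rule touches_le[OF inj less that])
    then have "real (touches piv i t) \<le> real CARD('n) - 1" using n by linarith
    then have "\<delta> * touches piv i t \<le> \<delta> * (real CARD('n) - 1)" using \<delta>0 by (intro mult_left_mono)
    then show ?thesis using \<delta>n by linarith
  qed
  let ?done = "\<lambda>i j t. \<exists>s<t. piv s = (i, j) \<or> piv s = (j, i)"
  \<comment> \<open>The three bounds need a common induction: the first and third supply the
    hypotheses of the next step. The second drops h because the entry was reset to zero; charging
    also the touches before the reset only weakens it.\<close>
  have "(\<forall>i j. i \<noteq> j \<longrightarrow> cmod (B t $ i $ j) \<le> h + \<delta> * (touches piv i t + touches piv j t))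
      \<and> (\<forall>i j. ?done i j t \<longrightarrow> cmod (B t $ i $ j) \<le> \<delta> * (touches piv i t + touches piv j t))
      \<and> (\<forall>i. cmod (B t $ i $ i - A $ i $ i) \<le> \<delta> * touches piv i t)"
    using \<open>t \<le> N\<close>
  proof (induction t)
    case 0
    then show ?case using bound by (simp add: B_def)
  next
    case (Suc t)
    then have "t \<le> N" by simp
    with Suc have IH1: "\<And>i j. i \<noteq> j \<Longrightarrow> cmod (B t $ i $ j) \<le> h + \<delta> * (touches piv i t + touches piv j t)"
      and IH2: "\<And>i j. ?done i j t \<Longrightarrow> cmod (B t $ i $ j) \<le> \<delta> * (touches piv i t + touches piv j t)"
      and IH3: "\<And>i. cmod (B t $ i $ i - A $ i $ i) \<le> \<delta> * touches piv i t"
      by auto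
    obtain p q where pq: "piv t = (p, q)" by fastforce
    have "p < q" using less[of t] Suc.prems pq by simp
    then have "p \<noteq> q" by simp
    have bd: "cmod (B t $ i $ j) \<le> 2 * h" if "i \<noteq> j" for i j
      using IH1[OF that] deg[OF \<open>t \<le> N\<close>, of i] deg[OF \<open>t \<le> N\<close>, of j] \<open>0 \<le> h\<close>
      by (simp add: distrib_left)
    have gp: "g / 2 \<le> cmod (B t $ i $ i - B t $ j $ j)" if "i \<noteq> j" for i j
    proof -
      have "cmod (A $ i $ i - A $ j $ j) = cmod ((B t $ i $ i - B t $ j $ j)
          - (B t $ i $ i - A $ i $ i) + (B t $ j $ j - A $ j $ j))"
        by simp
      also have "\<dots> \<le> cmod (B t $ i $ i - B t $ j $ j)
          + cmod (B t $ i $ i - A $ i $ i) + cmod (B t $ j $ j - A $ j $ j)"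
        by (meson add_mono norm_triangle_ineq norm_triangle_ineq4 order_refl order_trans)
      finally show ?thesis
        using gap[OF that] IH3[of i] IH3[of j] deg[OF \<open>t \<le> N\<close>, of i] deg[OF \<open>t \<le> N\<close>, of j] hg \<open>0 \<le> h\<close> \<open>0 < g\<close>
        by linarith
    qed
    \<comment> \<open>The constant 84/5 is 21/10 * 4 * 2, the single-step change at M = 2h and
      \<gamma> = g/2.\<close>
    have \<delta>_eq: "21 / 10 * (2 * h)\<^sup>2 / (g / 2) = \<delta>" by (simp add: \<delta>_def power_mult_distrib)
    have "B (Suc t) = jacobi_step rt (p, q) (B t)" by (simp add: B_def pq)
    with jacobi_step_change[where A = "B t", OF rt \<open>p \<noteq> q\<close> gp bd] \<open>0 < g\<close> hg
    have zero: "B (Suc t) $ p $ q = 0" "B (Suc t) $ q $ p = 0"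
      and change: "\<And>i j. {i, j} \<noteq> {p, q} \<Longrightarrow> cmod (B (Suc t) $ i $ j - B t $ i $ j) \<le> \<delta>"
      and same: "\<And>i j. i \<notin> {p, q} \<Longrightarrow> j \<notin> {p, q} \<Longrightarrow> B (Suc t) $ i $ j = B t $ i $ j"
      unfolding \<delta>_eq by auto
    \<comment> \<open>Away from the pivot positions, an entry with i \<noteq> j has at most one
      touched index, and with none touched it does not change. A diagonal entry is charged once,
      hence the case distinction.\<close>
    have ch: "cmod (B (Suc t) $ i $ j - B t $ i $ j) \<le> \<delta> * (touches piv i (Suc t) - touches piv i t)
        + \<delta> * (if i = j then 0 else touches piv j (Suc t) - touches piv j t)"
      if "{i, j} \<noteq> {p, q}" for i j
      using change[OF that] same[of i j] \<delta>0 by (auto simp: touches_Suc pq)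
    have mono: "touches piv i t \<le> touches piv i (Suc t)" for i by (simp add: touches_Suc)
    have ch': "cmod (B (Suc t) $ i $ j) \<le> cmod (B t $ i $ j)
        + (\<delta> * (touches piv i (Suc t) + touches piv j (Suc t)) - \<delta> * (touches piv i t + touches piv j t))"
      if "i \<noteq> j" "{i, j} \<noteq> {p, q}" for i j
      using ch[OF that(2)] that(1) norm_triangle_sub[of "B (Suc t) $ i $ j" "B t $ i $ j"] mono[of i] mono[of j]
      by (simp add: of_nat_diff algebra_simps)
    show ?case
    proof (intro conjI allI impI)
      fix i j :: 'n assume "i \<noteq> j"
      show "cmod (B (Suc t) $ i $ j) \<le> h + \<delta> * (touches piv i (Suc t) + touches piv j (Suc t))"
      proof (cases "{i, j} = {p, q}")
        case True
        then have "B (Suc t) $ i $ j = 0" using zero by (auto simp: doubleton_eq_iff)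
        then show ?thesis using \<open>0 \<le> h\<close> \<delta>0 by simp
      next
        case False
        then show ?thesis using ch'[OF \<open>i \<noteq> j\<close> False] IH1[OF \<open>i \<noteq> j\<close>] by linarith
      qed
    next
      fix i j assume d: "?done i j (Suc t)"
      show "cmod (B (Suc t) $ i $ j) \<le> \<delta> * (touches piv i (Suc t) + touches piv j (Suc t))"
      proof (cases "{i, j} = {p, q}")
        case True
        then have "B (Suc t) $ i $ j = 0" using zero by (auto simp: doubleton_eq_iff)
        then show ?thesis using \<delta>0 by simp
      next
        case False
        then have dt: "?done i j t" using d pq by (auto simp: less_Suc_eq)
        then obtain s where s: "s < t" "piv s = (i, j) \<or> piv s = (j, i)" by blast
        then have "i \<noteq> j" using less[of s] \<open>t \<le> N\<close> by auto
        then show ?thesis using ch'[OF _ False] IH2[OF dt] by linarith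
      qed
    next
      fix i
      have "{i, i} \<noteq> {p, q}" using \<open>p \<noteq> q\<close> by auto
      from ch[OF this] have "cmod (B (Suc t) $ i $ i - B t $ i $ i)
          \<le> \<delta> * touches piv i (Suc t) - \<delta> * touches piv i t"
        using mono[of i] by (simp add: of_nat_diff algebra_simps)
      then show "cmod (B (Suc t) $ i $ i - A $ i $ i) \<le> \<delta> * touches piv i (Suc t)"
        using IH3[of i] norm_triangle_ineq[of "B (Suc t) $ i $ i - B t $ i $ i" "B t $ i $ i - A $ i $ i"]
        by simp
    qed
  qed
  then show "i \<noteq> j \<Longrightarrow> cmod (B t $ i $ j) \<le> h + \<delta> * (touches piv i t + touches piv j t)"
    and "?done i j t \<Longrightarrow> cmod (B t $ i $ j) \<le> \<delta> * (touches piv i t + touches piv j t)"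
    and "cmod (B t $ i $ i - A $ i $ i) \<le> \<delta> * touches piv i t"
    by blast+
qed

text \<open>Allows a cycle to be treated as an iteration of its own, started at the current
  matrix.\<close>

lemma jacobi_iter_add:
  "jacobi_iter rt piv A (m + t) = jacobi_iter rt (\<lambda>s. piv (m + s)) (jacobi_iter rt piv A m) t"
  by (induction t) auto

section \<open>Largest off-diagonal entry, diagonal gap and off-norm\<close>

lemma finite_off_diag: "finite {f i j | i j. i \<noteq> (j :: 'n::finite)}"
proof (rule finite_subset)
  show "{f i j | i j. i \<noteq> j} \<subseteq> (\<lambda>(i, j). f i j) ` UNIV" by auto
qed simp

lemma max_off_ge: "i \<noteq> j \<Longrightarrow> cmod (A $ i $ j) \<le> max_off A"
  unfolding max_off_def by (rule Max_ge[OF finite_off_diag]) auto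

lemma diag_gap_le: "i \<noteq> j \<Longrightarrow> diag_gap A \<le> cmod (A $ i $ i - A $ j $ j)"
  unfolding diag_gap_def by (rule Min_le[OF finite_off_diag]) auto

text \<open>\<open>Max\<close> is meaningful only on a nonempty set, which two indices guarantee.
  The attaining entry lets entrywise bounds pass to the maximum.\<close>

lemma max_off_attained:
  fixes A :: "complex^'n^'n"
  assumes "CARD('n) \<ge> 2"
  obtains i j where "i \<noteq> j" "max_off A = cmod (A $ i $ j)"
proof -
  have "max_off A \<in> {cmod (A $ i $ j) | i j. i \<noteq> j}"
    unfolding max_off_def using exists_distinct[OF assms] by (intro Max_in finite_off_diag) auto
  then show ?thesis using that by auto
qed

lemma diag_gap_attained:
  fixes A :: "complex^'n^'n"
  assumes "CARD('n) \<ge> 2"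
  obtains i j where "i \<noteq> j" "diag_gap A = cmod (A $ i $ i - A $ j $ j)"
proof -
  have "diag_gap A \<in> {cmod (A $ i $ i - A $ j $ j) | i j. i \<noteq> j}"
    unfolding diag_gap_def using exists_distinct[OF assms] by (intro Min_in finite_off_diag) auto
  then show ?thesis using that by auto
qed

lemma max_off_le_off:
  fixes A :: "complex^'n^'n"
  assumes "CARD('n) \<ge> 2"
  shows "max_off A \<le> off A"
proof -
  obtain i j where ij: "i \<noteq> j" "max_off A = cmod (A $ i $ j)"
    using max_off_attained[OF assms] .
  have "(\<lambda>(i, j). (cmod (A $ i $ j))\<^sup>2) (i, j) \<le> (\<Sum>(i, j) \<in> {(i, j). i \<noteq> j}. (cmod (A $ i $ j))\<^sup>2)"
    by (rule member_le_sum) (use ij in auto)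
  then show ?thesis unfolding off_def ij(2) by (simp add: real_le_rsqrt)
qed

text \<open>There are n(n-1) = 2N ordered off-diagonal positions, each contributing at most the
  squared maximum; this is the source of the factor sqrt(2N).\<close>

lemma off_le_max_off:
  fixes A :: "complex^'n^'n"
  assumes "CARD('n) \<ge> 2"
  shows "off A \<le> sqrt (real (CARD('n) * (CARD('n) - 1))) * max_off A"
proof -
  have m0: "0 \<le> max_off A" using max_off_attained[OF assms] norm_ge_zero by metis
  have "{(i, j). i \<noteq> (j :: 'n)} = UNIV \<times> UNIV - range (\<lambda>i. (i, i))" by auto
  also have "card \<dots> = CARD('n) * CARD('n) - CARD('n)"
    by (subst card_Diff_subset) (auto simp: card_image inj_on_def card_cartesian_product)
  finally have card: "card {(i, j). i \<noteq> (j :: 'n)} = CARD('n) * (CARD('n) - 1)"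
    by (simp add: diff_mult_distrib2)
  have "(\<Sum>(i, j) \<in> {(i, j). i \<noteq> j}. (cmod (A $ i $ j))\<^sup>2)
      \<le> (\<Sum>(i, j) \<in> {(i, j). i \<noteq> (j :: 'n)}. (max_off A)\<^sup>2)"
    by (intro sum_mono) (auto intro!: power_mono max_off_ge)
  also have "\<dots> = real (CARD('n) * (CARD('n) - 1)) * (max_off A)\<^sup>2"
    using card by (simp add: case_prod_unfold)
  finally have "off A \<le> sqrt (real (CARD('n) * (CARD('n) - 1)) * (max_off A)\<^sup>2)"
    unfolding off_def by (rule real_sqrt_le_mono)
  then show ?thesis by (simp only: real_sqrt_mult real_sqrt_abs abs_of_nonneg[OF m0])
qed

section \<open>Induction over the cycles\<close>

theorem theorem3p7:
  fixes A :: "complex^('n::{finite,linorder})^('n::{finite,linorder})"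
    and rt :: "complex \<Rightarrow> complex"
    and piv :: "nat \<Rightarrow> 'n \<times> 'n"
    and N :: nat and C :: real
    and Ak :: "nat \<Rightarrow> complex^('n::{finite,linorder})^('n::{finite,linorder})" and \<mu> \<eta> :: "nat \<Rightarrow> real"
  assumes n: "CARD('n) \<ge> 3"
    and N: "N = CARD('n) * (CARD('n) - 1) div 2"
    and rt: "\<And>z. (rt z)\<^sup>2 = z"
    and piv: "cyclic_pivot_strategy piv"
    and Ak: "\<And>k. Ak k = jacobi_iter rt piv A k"
    and \<mu>: "\<And>k. \<mu> k = diag_gap (Ak k)"
    and \<eta>: "\<And>k. \<eta> k = max_off (Ak k)"
    and gap: "\<mu> 0 > 0"
    and small: "80 * (real CARD('n) - 1) * (\<eta> 0 / \<mu> 0) \<le> 1"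
    and C: "C = 80 * (real CARD('n) - 1) / \<mu> 0"
  shows "\<forall>k. \<eta> ((k + 1) * N) \<le> C * (\<eta> (k * N))\<^sup>2 \<and>
             off (Ak ((k + 1) * N)) \<le> C * sqrt (2 * real N) * (off (Ak (k * N)))\<^sup>2"
proof -
  let ?n = "real CARD('n)"
  define g where "g = \<mu> 0"
  have bij: "bij_betw piv {..<N} {(p, q). p < q}" and per: "\<And>k. piv (k + N) = piv k"
    using piv by (auto simp: cyclic_pivot_strategy_def Let_def N)
  have inj: "inj_on piv {..<N}" using bij by (rule bij_betw_imp_inj_on)
  have less: "fst (piv s) < snd (piv s)" if "s < N" for s
    using bij_betwE[OF bij] that by (auto simp: case_prod_unfold)
  have n2: "CARD('n) \<ge> 2" using n by simp
  have per': "piv (k * N + s) = piv s" for k s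
    by (induction k) (simp, metis per add.assoc add.commute mult_Suc)
  have "0 < g" using gap by (simp add: g_def)
  have C0: "0 < C" using n \<open>0 < g\<close> by (simp add: C g_def)
  have C\<eta>0: "C * \<eta> 0 \<le> 1" using small by (simp add: C)
  have \<eta>_nonneg: "0 \<le> \<eta> k" for k
    unfolding \<eta> using max_off_attained[OF n2] norm_ge_zero by metis
  have "160 * \<eta> 0 \<le> 80 * (?n - 1) * \<eta> 0"
    using n \<eta>_nonneg by (intro mult_right_mono) auto
  moreover have "80 * (?n - 1) * \<eta> 0 \<le> g" using small \<open>0 < g\<close> by (simp add: g_def field_simps)
  ultimately have \<eta>g: "160 * \<eta> 0 \<le> g" by linarith
  \<comment> \<open>The factor C/2 in place of C is what makes \<open>\<eta>\<close> halve per
    cycle, and with it the loss of gap stays summable.\<close>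
  have cycle: "\<eta> ((k + 1) * N) \<le> C / 2 * (\<eta> (k * N))\<^sup>2 \<and> \<mu> (k * N) - \<eta> (k * N) / 2 \<le> \<mu> ((k + 1) * N)"
    if \<eta>k: "\<eta> (k * N) \<le> \<eta> 0" and \<mu>k: "9 / 10 * g \<le> \<mu> (k * N)" for k
  proof -
    define B h where "B = Ak (k * N)" and "h = \<eta> (k * N)"
    define \<delta> where "\<delta> = 84 / 5 * h\<^sup>2 / g"
    have B': "Ak ((k + 1) * N) = jacobi_iter rt piv B N"
      using jacobi_iter_add[of rt piv A "k * N" N] by (simp only: B_def Ak per') (simp add: add.commute)
    have h0: "0 \<le> h" by (simp add: h_def \<eta>_nonneg)
    have gB: "9 / 10 * g \<le> cmod (B $ i $ i - B $ j $ j)" if "i \<noteq> j" for i j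
      using diag_gap_le[OF that, of B] \<mu>k by (simp add: B_def \<mu>)
    have bB: "cmod (B $ i $ j) \<le> h" if "i \<noteq> j" for i j
      using max_off_ge[OF that, of B] by (simp add: B_def h_def \<eta>)
    have "80 * (?n - 1) * h \<le> 80 * (?n - 1) * \<eta> 0"
      using n \<eta>k by (intro mult_left_mono) (auto simp: h_def)
    then have sB: "80 * (?n - 1) * h \<le> g"
      using \<open>80 * (?n - 1) * \<eta> 0 \<le> g\<close> by linarith
    have off_diag: "cmod (jacobi_iter rt piv B N $ i $ j) \<le> \<delta> * (touches piv i N + touches piv j N)"
      if "\<exists>s<N. piv s = (i, j) \<or> piv s = (j, i)" for i j
      unfolding \<delta>_def
      by (rule jacobi_cycle(2)[OF rt inj less gB bB \<open>0 < g\<close> sB n order_refl that])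
    have diag: "cmod (jacobi_iter rt piv B N $ i $ i - B $ i $ i) \<le> \<delta> * touches piv i N" for i
      unfolding \<delta>_def
      by (rule jacobi_cycle(3)[OF rt inj less gB bB \<open>0 < g\<close> sB n order_refl])
    have \<delta>0: "0 \<le> \<delta>" using \<open>0 < g\<close> by (simp add: \<delta>_def)
    have deg: "\<delta> * touches piv i N \<le> \<delta> * (?n - 1)" for i
      using touches_le[OF inj less order_refl, of i] n \<delta>0 by (intro mult_left_mono) auto
    \<comment> \<open>The factor 21/100 is (84/5)/80. Two indices together give 42/100, which fits
      below the 1/2 claimed for both \<open>\<eta>\<close> and the gap.\<close>
    have \<delta>n: "\<delta> * (?n - 1) = 21 / 100 * C * h\<^sup>2"
      using gap by (simp add: \<delta>_def C g_def field_simps)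
    have Ch: "C * h\<^sup>2 \<le> h"
    proof -
      have "C * h \<le> C * \<eta> 0" using \<eta>k C0 by (simp add: h_def)
      then have "(C * h) * h \<le> 1 * h" using C\<eta>0 h0 by (intro mult_right_mono) auto
      then show ?thesis by (simp add: power2_eq_square)
    qed
    have "\<eta> ((k + 1) * N) \<le> C / 2 * h\<^sup>2"
    proof -
      obtain i j where ij: "i \<noteq> j" "\<eta> ((k + 1) * N) = cmod (jacobi_iter rt piv B N $ i $ j)"
        using max_off_attained[OF n2, of "jacobi_iter rt piv B N"] unfolding \<eta> B' by metis
      \<comment> \<open>Every off-diagonal position or its transpose is a pivot of the cycle, so the
        bound without the initial h applies to the maximal entry.\<close>
      have "\<exists>s<N. piv s = (i, j) \<or> piv s = (j, i)"
      proof -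
        have "(i, j) \<in> {(p, q). p < q} \<or> (j, i) \<in> {(p, q). p < q}" using ij by auto
        then show ?thesis unfolding bij_betw_imp_surj_on[OF bij, symmetric] by force
      qed
      from off_diag[OF this] ij deg[of i] deg[of j] \<delta>n
      have "\<eta> ((k + 1) * N) \<le> 42 / 100 * (C * h\<^sup>2)" by (simp add: distrib_left)
      moreover have "0 \<le> C * h\<^sup>2" using C0 by simp
      ultimately show ?thesis by simp
    qed
    moreover have "\<mu> (k * N) - h / 2 \<le> \<mu> ((k + 1) * N)"
    proof -
      let ?B = "jacobi_iter rt piv B N"
      obtain i j where ij: "i \<noteq> j" "\<mu> ((k + 1) * N) = cmod (?B $ i $ i - ?B $ j $ j)"
        using diag_gap_attained[OF n2, of ?B] unfolding \<mu> B' by metis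
      have "\<mu> (k * N) \<le> cmod (B $ i $ i - B $ j $ j)"
        unfolding \<mu> B_def by (rule diag_gap_le) fact
      also have "\<dots> = cmod ((?B $ i $ i - ?B $ j $ j)
          - (?B $ i $ i - B $ i $ i) + (?B $ j $ j - B $ j $ j))"
        by simp
      also have "\<dots> \<le> cmod (?B $ i $ i - ?B $ j $ j)
          + cmod (?B $ i $ i - B $ i $ i) + cmod (?B $ j $ j - B $ j $ j)"
        by (meson add_mono norm_triangle_ineq norm_triangle_ineq4 order_refl order_trans)
      finally show ?thesis
        using ij diag[of i] diag[of j] deg[of i] deg[of j] \<delta>n Ch h0 by linarith
    qed
    ultimately show ?thesis by (simp add: h_def)
  qed
  \<comment> \<open>Since the off-diagonal bound at least halves per cycle, the total loss of the diagonal gap telescopes.\<close>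
  have inv: "\<eta> (k * N) \<le> \<eta> 0 \<and> \<mu> 0 - \<eta> 0 \<le> \<mu> (k * N) - \<eta> (k * N)" for k
  proof (induction k)
    case (Suc k)
    \<comment> \<open>The gap is at least \<open>\<mu> 0 - \<eta> 0\<close>, hence at least (1 -
      1/160) g.\<close>
    then have "9 / 10 * g \<le> \<mu> (k * N)" using \<eta>g \<eta>_nonneg[of "k * N"] \<open>0 < g\<close> by (simp add: g_def)
    note c = cycle[OF conjunct1[OF Suc] this]
    have "C * \<eta> (k * N) \<le> C * \<eta> 0" using Suc C0 by simp
    then have "(C * \<eta> (k * N)) * \<eta> (k * N) \<le> 1 * \<eta> (k * N)"
      using C\<eta>0 \<eta>_nonneg by (intro mult_right_mono) auto
    then have "\<eta> ((k + 1) * N) \<le> \<eta> (k * N) / 2" using c by (simp add: power2_eq_square)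
    moreover have "\<mu> (k * N) - \<eta> (k * N) / 2 \<le> \<mu> ((k + 1) * N)" using c by blast
    \<comment> \<open>The gap loses at most half of \<open>\<eta>\<close> while
      \<open>\<eta>\<close> itself drops by at least half, so their difference does not
      decrease.\<close>
    ultimately have "\<eta> ((k + 1) * N) \<le> \<eta> 0 \<and> \<mu> 0 - \<eta> 0 \<le> \<mu> ((k + 1) * N) - \<eta> ((k + 1) * N)"
      using Suc \<eta>_nonneg[of "k * N"] by linarith
    then show ?case by simp
  qed simp
  show ?thesis
  proof (intro allI conjI)
    fix k
    have "9 / 10 * g \<le> \<mu> (k * N)" using inv[of k] \<eta>g \<eta>_nonneg[of "k * N"] \<open>0 < g\<close> by (simp add: g_def)
    then have "\<eta> ((k + 1) * N) \<le> C / 2 * (\<eta> (k * N))\<^sup>2" using cycle inv by blast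
    moreover have "0 \<le> C * (\<eta> (k * N))\<^sup>2" using C0 by simp
    ultimately show q: "\<eta> ((k + 1) * N) \<le> C * (\<eta> (k * N))\<^sup>2" by simp
    \<comment> \<open>Evenness makes the integer division in N exact.\<close>
    have "even (CARD('n) * (CARD('n) - 1))" by simp
    then have N2: "2 * real N = real (CARD('n) * (CARD('n) - 1))"
      unfolding N by (metis dvd_mult_div_cancel of_nat_mult of_nat_numeral)
    \<comment> \<open>The off-norm estimate follows from the one for \<open>\<eta>\<close> because
      the off-norm lies between \<open>max_off\<close> and sqrt(2N) times
      \<open>max_off\<close>.\<close>
    have "(\<eta> (k * N))\<^sup>2 \<le> (off (Ak (k * N)))\<^sup>2"
      using max_off_le_off[OF n2] \<eta>_nonneg unfolding \<eta> by (intro power_mono) auto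
    then have "C * (\<eta> (k * N))\<^sup>2 \<le> C * (off (Ak (k * N)))\<^sup>2" using C0 by simp
    with q have "\<eta> ((k + 1) * N) \<le> C * (off (Ak (k * N)))\<^sup>2" by linarith
    then have "sqrt (2 * real N) * \<eta> ((k + 1) * N) \<le> sqrt (2 * real N) * (C * (off (Ak (k * N)))\<^sup>2)"
      by (intro mult_left_mono) auto
    moreover have "off (Ak ((k + 1) * N)) \<le> sqrt (2 * real N) * \<eta> ((k + 1) * N)"
      unfolding N2 \<eta> by (rule off_le_max_off[OF n2])
    ultimately show "off (Ak ((k + 1) * N)) \<le> C * sqrt (2 * real N) * (off (Ak (k * N)))\<^sup>2"
      by (simp add: mult_ac)
  qed
qed

end
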